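(* For every $n,\Delta\in\mathbb Z$ with $n\ge1$, $\Delta\ge1$, and every $\beta\in(0,1)$, there exists an Integer Linear Programming problem (ILP) in $n$ variables, with subdeterminant $\Delta$, such that, denoting by (LP) its standard linear relaxation, $$\min\{\|x^c-x^d\|_\infty : x^d \text{ optimal to (ILP)},\ x^c\text{ optimal to (LP)}\}=(n-1)\beta\Delta.$$ In particular, for fixed $\beta$ this quantity is in $\Omega(n\Delta)$.
   Context: An (ILP) is a problem $\min\{h^{\mathsf T}x : Ax\le b,\ x\in\mathbb Z^n\}$ with $A$ an integer matrix with $n$ columns and $b$, $h$ real vectors; its standard linear relaxation (LP) is $\min\{h^{\mathsf T}x : Ax\le b,\ x\in\mathbb R^n\}$. The problem (ILP) has subdeterminant $\Delta$ if the maximum of the absolute values of the subdeterminants (determinants of square submatrices) of $A$ is $\Delta$. The statement that the quantity is in $\Omega(n\Delta)$ is asymptotic: for fixed $\beta$ there are constants $c>0$ and $n_0$ such that $(n-1)\beta\Delta\ge c\,n\Delta$ for all $n\ge n_0$ and all $\Delta\ge1$. *)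

theory Defs
  imports
    Complex_Main
    "Jordan_Normal_Form.Determinant"
    "Jordan_Normal_Form.DL_Submatrix"
begin

definition is_minimum :: "real set \<Rightarrow> real \<Rightarrow> bool" where
  "is_minimum S v \<longleftrightarrow> v \<in> S \<and> (\<forall>s\<in>S. v \<le> s)"

(* Index sets are nonempty, so the empty determinant (equal to 1) is not counted. *)
definition abs_subdeterminants :: "int mat \<Rightarrow> int set" where
  "abs_subdeterminants A =
     {\<bar>det (submatrix A I J)\<bar> | I J.
        I \<subseteq> {..<dim_row A} \<and> J \<subseteq> {..<dim_col A} \<and> card I = card J \<and> I \<noteq> {}}"

definition has_subdeterminant :: "int mat \<Rightarrow> int \<Rightarrow> bool" where
  "has_subdeterminant A \<Delta> \<longleftrightarrow>
     \<Delta> \<in> abs_subdeterminants A \<and> (\<forall>d\<in>abs_subdeterminants A. d \<le> \<Delta>)"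

(* The data of min {h x : A x \<le> b}; the number of constraints m is arbitrary. *)
definition ilp_data :: "nat \<Rightarrow> int mat \<Rightarrow> real vec \<Rightarrow> real vec \<Rightarrow> bool" where
  "ilp_data n A b h \<longleftrightarrow>
     (\<exists>m. A \<in> carrier_mat m n \<and> b \<in> carrier_vec m) \<and> h \<in> carrier_vec n"

definition lp_feasible :: "int mat \<Rightarrow> real vec \<Rightarrow> real vec set" where
  "lp_feasible A b =
     {x \<in> carrier_vec (dim_col A). map_mat real_of_int A *\<^sub>v x \<le> b}"

definition ilp_feasible :: "int mat \<Rightarrow> real vec \<Rightarrow> real vec set" where
  "ilp_feasible A b = {x \<in> lp_feasible A b. \<forall>i<dim_vec x. x $ i \<in> \<int>}"

definition minimizers :: "real vec \<Rightarrow> real vec set \<Rightarrow> real vec set" where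
  "minimizers h S = {x \<in> S. \<forall>y\<in>S. h \<bullet> x \<le> h \<bullet> y}"

definition lp_optimal :: "int mat \<Rightarrow> real vec \<Rightarrow> real vec \<Rightarrow> real vec set" where
  "lp_optimal A b h = minimizers h (lp_feasible A b)"

definition ilp_optimal :: "int mat \<Rightarrow> real vec \<Rightarrow> real vec \<Rightarrow> real vec set" where
  "ilp_optimal A b h = minimizers h (ilp_feasible A b)"

(* Inserting 0 changes the value only in dimension 0, where Max {} would be unspecified. *)
definition inf_norm :: "real vec \<Rightarrow> real" where
  "inf_norm x = Max (insert 0 ((\<lambda>i. \<bar>x $ i\<bar>) ` {..<dim_vec x}))"

definition optimal_distances :: "int mat \<Rightarrow> real vec \<Rightarrow> real vec \<Rightarrow> real set" where
  "optimal_distances A b h =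
     {inf_norm (xc - xd) | xc xd. xd \<in> ilp_optimal A b h \<and> xc \<in> lp_optimal A b h}"

end

theory Submission
  imports Defs
begin

text \<open>
  Take the constraints \<open>x\<^sub>i \<le> \<beta>\<close> for \<open>i < n\<close> and \<open>x\<^sub>n \<le> \<Delta> (x\<^sub>1 + \<dots> + x\<^bsub>n-1\<^esub>)\<close>, and maximise \<open>x\<^sub>n\<close>.
  The relaxation reaches \<open>x\<^sub>n = (n-1)\<beta>\<Delta>\<close>, while integrality forces \<open>x\<^sub>i \<le> 0\<close> and hence
  \<open>x\<^sub>n = 0\<close> at the optimum; the distance is then attained in the last coordinate.
  All rows but the last are unit vectors, so Laplace expansion along them bounds every
  subdeterminant by a single entry of the matrix.
\<close>

text \<open>Induction on the size: expanding along row 0 leaves at most one term, whose entry has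
  absolute value at most 1, and the minor that remains has the same shape. The upper rows may vanish
  instead of being unit vectors, because a submatrix can lose the column holding the 1.\<close>

lemma abs_det_le_if_sparse_rows:
  fixes B :: "'a :: linordered_idom mat"
  assumes "B \<in> carrier_mat (Suc k) (Suc k)"
    and "\<And>j. j \<le> k \<Longrightarrow> \<bar>B $$ (k, j)\<bar> \<le> D"
    and "\<And>i j. i < k \<Longrightarrow> j \<le> k \<Longrightarrow> \<bar>B $$ (i, j)\<bar> \<le> 1"
    and "\<And>i j j'. i < k \<Longrightarrow> j \<le> k \<Longrightarrow> j' \<le> k \<Longrightarrow> j \<noteq> j' \<Longrightarrow> B $$ (i, j) = 0 \<or> B $$ (i, j') = 0"
  shows "\<bar>det B\<bar> \<le> D"
  using assms
proof (induction k arbitrary: B)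
  case 0
  then show ?case by (simp add: det_single)
next
  case (Suc k)
  have D: "0 \<le> D" using Suc.prems(2)[of 0] by (meson abs_ge_zero order_trans zero_le)
  have expand: "det B = (\<Sum>j<Suc (Suc k). B $$ (0, j) * cofactor B 0 j)"
    using laplace_expansion_row[OF Suc.prems(1), of 0] by simp
  show ?case
  proof (cases "\<exists>l \<le> Suc k. B $$ (0, l) \<noteq> 0")
    case False
    then have "det B = 0" unfolding expand by (intro sum.neutral) auto
    then show ?thesis using D by simp
  next
    case True
    then obtain l where l: "l \<le> Suc k" "B $$ (0, l) \<noteq> 0" by blast
    define C where "C = mat_delete B 0 l"
    have C: "C \<in> carrier_mat (Suc k) (Suc k)"
      unfolding C_def using mat_delete_carrier[OF Suc.prems(1)] by simp
    \<comment> \<open>Deleting row 0 keeps the distinguished last row in last place, and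
      \<open>insert_index l\<close> is injective, so all hypotheses pass to the minor.\<close>
    have index: "C $$ (i, j) = B $$ (Suc i, insert_index l j)" "insert_index l j \<le> Suc k"
      if "i \<le> k" "j \<le> k" for i j
      using mat_delete_index[OF Suc.prems(1), of 0 l i j] l that
      unfolding C_def by (auto simp: insert_index_def)
    have bound: "\<bar>det C\<bar> \<le> D"
    proof (rule Suc.IH[OF C])
      fix i j j' assume "i < k" "j \<le> k" "j' \<le> k" "j \<noteq> j'"
      then show "C $$ (i, j) = 0 \<or> C $$ (i, j') = 0"
        using Suc.prems(4)[of "Suc i" "insert_index l j" "insert_index l j'"] index
        by (auto simp: insert_index_def split: if_splits)
    qed (use Suc.prems(2,3) index in auto)
    \<comment> \<open>Column \<open>l\<close> holds the only nonzero entry of row 0, so the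
      expansion collapses to one term.\<close>
    have "det B = (\<Sum>j\<in>{l}. B $$ (0, j) * cofactor B 0 j)"
      unfolding expand using l Suc.prems(4)[of 0 _ l]
      by (intro sum.mono_neutral_right) (auto simp: less_Suc_eq_le)
    then have "\<bar>det B\<bar> = \<bar>B $$ (0, l)\<bar> * \<bar>det C\<bar>"
      by (simp add: cofactor_def C_def abs_mult power_abs)
    also have "\<dots> \<le> 1 * D"
      using Suc.prems(3)[of 0 l] l bound by (intro mult_mono) auto
    finally show ?thesis by simp
  qed
qed

text \<open>
  The bottom right entry differs for \<open>N = 0\<close> because there it is the only entry,
  and the subdeterminant still has to be \<open>\<Delta>\<close>.
\<close>

definition gap_mat :: "nat \<Rightarrow> int \<Rightarrow> int mat" where
  "gap_mat N \<Delta> = mat (Suc N) (Suc N) (\<lambda>(i, j).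
     if i < N then (if i = j then 1 else 0)
     else if j < N then - \<Delta> else if N = 0 then \<Delta> else 1)"

definition gap_rhs :: "nat \<Rightarrow> real \<Rightarrow> real vec" where
  "gap_rhs N \<beta> = vec (Suc N) (\<lambda>i. if i < N then \<beta> else 0)"

text \<open>The sign turns maximising the last coordinate into a minimisation.\<close>

definition gap_obj :: "nat \<Rightarrow> real vec" where
  "gap_obj N = - unit_vec (Suc N) N"

lemma gap_mat_carrier: "gap_mat N \<Delta> \<in> carrier_mat (Suc N) (Suc N)"
  by (simp add: gap_mat_def)

lemma gap_mat_index:
  "i \<le> N \<Longrightarrow> j \<le> N \<Longrightarrow> gap_mat N \<Delta> $$ (i, j) =
    (if i < N then (if i = j then 1 else 0)
     else if j < N then - \<Delta> else if N = 0 then \<Delta> else 1)"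
  by (simp add: gap_mat_def)

lemma ilp_data_gap: "ilp_data (Suc N) (gap_mat N \<Delta>) (gap_rhs N \<beta>) (gap_obj N)"
  unfolding ilp_data_def gap_rhs_def gap_obj_def using gap_mat_carrier by auto

lemma has_subdeterminant_gap_mat:
  assumes "1 \<le> \<Delta>"
  shows "has_subdeterminant (gap_mat N \<Delta>) \<Delta>"
  unfolding has_subdeterminant_def
proof (intro conjI ballI)
  let ?A = "gap_mat N \<Delta>"
  have dims: "dim_row ?A = Suc N" "dim_col ?A = Suc N" by (simp_all add: gap_mat_def)
  \<comment> \<open>The dimensions and \<open>pick\<close> of a singleton selection simplify to
    these two forms; they identify the selected block with the entry in row \<open>N\<close>, column
    0.\<close>
  have eq: "{i. i = a \<and> i < Suc N} = {a}" if "a \<le> N" for a using that by auto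
  have least: "(LEAST a. a = c) = c" for c :: nat by (rule Least_equality) auto
  have "submatrix ?A {N} {0} \<in> carrier_mat 1 1"
    by (rule carrier_matI) (simp_all add: dim_submatrix dims eq)
  then have "det (submatrix ?A {N} {0}) = submatrix ?A {N} {0} $$ (0, 0)"
    by (simp add: det_single)
  also have "\<dots> = ?A $$ (N, 0)"
    by (subst submatrix_index) (simp_all add: dims eq least)
  finally have "\<bar>det (submatrix ?A {N} {0})\<bar> = \<Delta>"
    using assms by (simp add: gap_mat_def)
  then show "\<Delta> \<in> abs_subdeterminants ?A"
    unfolding abs_subdeterminants_def dims
    by (intro CollectI exI[of _ "{N}"] exI[of _ "{0}"]) simp
next
  let ?A = "gap_mat N \<Delta>"
  have dims: "dim_row ?A = Suc N" "dim_col ?A = Suc N" by (simp_all add: gap_mat_def)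
  fix d assume "d \<in> abs_subdeterminants ?A"
  then obtain I J where IJ: "I \<subseteq> {..<Suc N}" "J \<subseteq> {..<Suc N}" "card I = card J" "I \<noteq> {}"
    and d: "d = \<bar>det (submatrix ?A I J)\<bar>"
    unfolding abs_subdeterminants_def dims by blast
  have "finite I" using IJ(1) finite_subset by blast
  then obtain k where k: "card I = Suc k"
    using IJ(4) by (metis card_eq_0_iff not0_implies_Suc)
  have sets: "{i. i < Suc N \<and> i \<in> I} = I" "{i. i < Suc N \<and> i \<in> J} = J" using IJ by auto
  have carrier: "submatrix ?A I J \<in> carrier_mat (Suc k) (Suc k)"
    by (rule carrier_matI) (use IJ k in \<open>simp_all add: dim_submatrix dims sets\<close>)
  have entry: "submatrix ?A I J $$ (i, j) = ?A $$ (pick I i, pick J j)"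
    if "i \<le> k" "j \<le> k" for i j
    by (subst submatrix_index) (use IJ k that in \<open>simp_all add: dims sets\<close>)
  have I: "pick I i \<le> N" if "i \<le> k" for i
    using pick_in_set_le[of i I] k IJ(1) that by force
  have J: "pick J i \<le> N" if "i \<le> k" for i
    using pick_in_set_le[of i J] k IJ that by force
  \<comment> \<open>\<open>pick\<close> is strictly increasing, so only the last selected row can be
    row \<open>N\<close>. If \<open>N\<close> is not selected, the last row too is part of a unit
    row, and its entries are at most 1 \<le> \<Delta>.\<close>
  have upper: "pick I i < N" if "i < k" for i
    using pick_mono_le[of k I i] k that I[of k] by simp
  \<comment> \<open>Distinct columns of the submatrix come from distinct columns of the full matrix,
    so a restricted unit row has at most one nonzero entry.\<close>
  have inj: "pick J j \<noteq> pick J j'" if "j \<le> k" "j' \<le> k" "j \<noteq> j'" for j j'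
    using pick_eq_iff_inf pick_mono_le[of j J j'] pick_mono_le[of j' J j] k IJ(3) that
    by (cases j j' rule: linorder_cases) auto
  have "\<bar>det (submatrix ?A I J)\<bar> \<le> \<Delta>"
    by (rule abs_det_le_if_sparse_rows[OF carrier])
       (use assms I J upper inj in \<open>auto simp: entry gap_mat_index\<close>)
  then show "d \<le> \<Delta>" using d by simp
qed

lemma lp_feasible_gap:
  assumes "1 \<le> \<Delta>"
  shows "x \<in> lp_feasible (gap_mat N \<Delta>) (gap_rhs N \<beta>) \<longleftrightarrow>
    x \<in> carrier_vec (Suc N) \<and> (\<forall>i<N. x $ i \<le> \<beta>) \<and> x $ N \<le> \<Delta> * (\<Sum>j<N. x $ j)"
proof (cases "x \<in> carrier_vec (Suc N)")
  case False
  then show ?thesis by (simp add: lp_feasible_def gap_mat_def)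
next
  case x: True
  let ?A = "map_mat real_of_int (gap_mat N \<Delta>)"
  have row: "(?A *\<^sub>v x) $ i = (\<Sum>j<Suc N. real_of_int (gap_mat N \<Delta> $$ (i, j)) * x $ j)" if "i \<le> N" for i
    using that x unfolding gap_mat_def
    by (auto simp: scalar_prod_def atLeast0LessThan less_Suc_eq_le simp del: sum.lessThan_Suc intro!: sum.cong)
  have upper: "(?A *\<^sub>v x) $ i = x $ i" if "i < N" for i
  proof -
    have "(?A *\<^sub>v x) $ i = (\<Sum>j<Suc N. if i = j then x $ j else 0)"
      using that by (subst row, simp, intro sum.cong) (auto simp: gap_mat_def)
    then show ?thesis using that by (simp add: sum.delta' del: sum.lessThan_Suc)
  qed
  have last: "(?A *\<^sub>v x) $ N = (if N = 0 then \<Delta> else 1) * x $ N - \<Delta> * (\<Sum>j<N. x $ j)"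
    by (subst row) (auto simp: gap_mat_def sum_distrib_left sum_negf)
  have "(?A *\<^sub>v x \<le> gap_rhs N \<beta>) \<longleftrightarrow> (\<forall>i<Suc N. (?A *\<^sub>v x) $ i \<le> gap_rhs N \<beta> $ i)"
    by (simp add: less_eq_vec_def gap_rhs_def gap_mat_def)
  also have "\<dots> \<longleftrightarrow> (\<forall>i<N. x $ i \<le> \<beta>) \<and> x $ N \<le> \<Delta> * (\<Sum>j<N. x $ j)"
    \<comment> \<open>For \<open>N = 0\<close> the last row reads
      \<open>\<Delta> * x $ 0 \<le> 0\<close>; since \<Delta> is positive, this is the same as
      \<open>x $ 0 \<le> 0\<close>, and the special corner entry disappears.\<close>
    using assms by (auto simp: upper last gap_rhs_def less_Suc_eq mult_le_0_iff)
  finally show ?thesis using x by (simp add: lp_feasible_def gap_mat_def)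
qed

lemma gap_obj_scalar_prod:
  "x \<in> carrier_vec (Suc N) \<Longrightarrow> gap_obj N \<bullet> x = - x $ N"
  by (simp add: gap_obj_def)

lemma abs_index_le_inf_norm: "i < dim_vec x \<Longrightarrow> \<bar>x $ i\<bar> \<le> inf_norm x"
  unfolding inf_norm_def by (intro Max_ge) auto

lemma inf_norm_le_iff:
  "inf_norm x \<le> c \<longleftrightarrow> 0 \<le> c \<and> (\<forall>i<dim_vec x. \<bar>x $ i\<bar> \<le> c)"
  unfolding inf_norm_def by (subst Max_le_iff) auto

text \<open>Summing the bounds \<open>x $ j \<le> \<beta>\<close> caps the last coordinate at
  \<open>N * \<beta> * \<Delta>\<close>; the vector that makes every constraint tight reaches the
  cap.\<close>

lemma lp_optimal_gap:
  assumes "1 \<le> \<Delta>"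
  shows "x \<in> lp_optimal (gap_mat N \<Delta>) (gap_rhs N \<beta>) (gap_obj N) \<longleftrightarrow>
    x \<in> lp_feasible (gap_mat N \<Delta>) (gap_rhs N \<beta>) \<and> x $ N = N * \<beta> * \<Delta>"
proof -
  let ?F = "lp_feasible (gap_mat N \<Delta>) (gap_rhs N \<beta>)"
  let ?x = "vec (Suc N) (\<lambda>i. if i < N then \<beta> else N * \<beta> * \<Delta>)"
  have carrier: "y \<in> carrier_vec (Suc N)" if "y \<in> ?F" for y
    using that by (simp add: lp_feasible_gap[OF assms])
  have le: "y $ N \<le> N * \<beta> * \<Delta>" if "y \<in> ?F" for y
  proof -
    have "(\<Sum>j<N. y $ j) \<le> N * \<beta>"
      using that sum_bounded_above[of "{..<N}" "\<lambda>j. y $ j" \<beta>]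
      by (simp add: lp_feasible_gap[OF assms])
    then have "\<Delta> * (\<Sum>j<N. y $ j) \<le> \<Delta> * (N * \<beta>)"
      using assms by (intro mult_left_mono) auto
    then show ?thesis using that by (simp add: lp_feasible_gap[OF assms] mult.commute)
  qed
  have "?x \<in> ?F" "?x $ N = N * \<beta> * \<Delta>" by (auto simp: lp_feasible_gap[OF assms])
  then show ?thesis
    unfolding lp_optimal_def minimizers_def
    using le carrier by (fastforce simp: gap_obj_scalar_prod)
qed

lemma ilp_optimal_gap:
  assumes "1 \<le> \<Delta>" "0 < \<beta>" "\<beta> < 1"
  shows "x \<in> ilp_optimal (gap_mat N \<Delta>) (gap_rhs N \<beta>) (gap_obj N) \<longleftrightarrow>
    x \<in> ilp_feasible (gap_mat N \<Delta>) (gap_rhs N \<beta>) \<and> x $ N = 0"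
proof -
  let ?F = "ilp_feasible (gap_mat N \<Delta>) (gap_rhs N \<beta>)"
  have carrier: "y \<in> carrier_vec (Suc N)" if "y \<in> ?F" for y
    using that by (simp add: ilp_feasible_def lp_feasible_gap[OF assms(1)])
  have le: "y $ N \<le> 0" if "y \<in> ?F" for y
  proof -
    have "y $ j \<le> 0" if "j < N" for j
    proof -
      have "y $ j \<in> \<int>" "y $ j \<le> \<beta>"
        using \<open>y \<in> ?F\<close> that by (auto simp: ilp_feasible_def lp_feasible_gap[OF assms(1)])
      then show ?thesis using assms(3) by (auto elim!: Ints_cases)
    qed
    then have "\<Delta> * (\<Sum>j<N. y $ j) \<le> 0"
      using assms(1) by (intro mult_nonneg_nonpos sum_nonpos) auto
    then show ?thesis using that by (simp add: ilp_feasible_def lp_feasible_gap[OF assms(1)])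
  qed
  \<comment> \<open>The origin satisfies the upper bounds because \<beta> is positive, so the bound
    0 on the last coordinate is attained.\<close>
  have "0\<^sub>v (Suc N) \<in> ?F" "0\<^sub>v (Suc N) $ N = (0 :: real)"
    using assms by (auto simp: ilp_feasible_def lp_feasible_gap[OF assms(1)])
  then show ?thesis
    unfolding ilp_optimal_def minimizers_def
    using le carrier by (fastforce simp: gap_obj_scalar_prod)
qed

text \<open>Every pair of optima differs by exactly \<open>N * \<beta> * \<Delta>\<close> in the
  last coordinate, which bounds the distance from below; the two explicit optima attain it.\<close>

lemma is_minimum_optimal_distances_gap:
  assumes "1 \<le> \<Delta>" "0 < \<beta>" "\<beta> < 1"
  shows "is_minimum (optimal_distances (gap_mat N \<Delta>) (gap_rhs N \<beta>) (gap_obj N)) (N * \<beta> * \<Delta>)"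
proof -
  note feasible = lp_feasible_gap[OF assms(1)]
  note optimal = lp_optimal_gap[OF assms(1)] ilp_optimal_gap[OF assms]
  let ?S = "optimal_distances (gap_mat N \<Delta>) (gap_rhs N \<beta>) (gap_obj N)"
  have lower: "N * \<beta> * \<Delta> \<le> s" if s_mem: "s \<in> ?S" for s
  proof -
    obtain xc xd where s: "s = inf_norm (xc - xd)"
      and x: "xc \<in> carrier_vec (Suc N)" "xd \<in> carrier_vec (Suc N)"
        "xc $ N = N * \<beta> * \<Delta>" "xd $ N = 0"
      using s_mem by (auto simp: optimal_distances_def optimal ilp_feasible_def feasible)
    have "\<bar>(xc - xd) $ N\<bar> \<le> s" unfolding s using x by (intro abs_index_le_inf_norm) simp
    then show ?thesis using x by simp
  qed
  let ?x = "vec (Suc N) (\<lambda>i. if i < N then \<beta> else N * \<beta> * \<Delta>)"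
  have "?x \<in> lp_optimal (gap_mat N \<Delta>) (gap_rhs N \<beta>) (gap_obj N)"
    by (auto simp: optimal feasible)
  moreover have "0\<^sub>v (Suc N) \<in> ilp_optimal (gap_mat N \<Delta>) (gap_rhs N \<beta>) (gap_obj N)"
    using assms by (auto simp: optimal ilp_feasible_def feasible)
  ultimately have mem: "inf_norm (?x - 0\<^sub>v (Suc N)) \<in> ?S"
    unfolding optimal_distances_def by blast
  \<comment> \<open>The explicit optima differ by \<beta> in each of the first \<open>N\<close>
    coordinates; this does not exceed the difference in the last one, as \<open>N * \<Delta>\<close>
    is at least 1 whenever such coordinates exist.\<close>
  have "\<beta> \<le> N * \<beta> * \<Delta>" if "0 < N"
  proof -
    have "1 * 1 \<le> real N * \<Delta>" using that assms(1) by (intro mult_mono) auto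
    then have "\<beta> * 1 \<le> \<beta> * (real N * \<Delta>)" using assms(2) by (intro mult_left_mono) auto
    then show ?thesis by (simp add: mult_ac)
  qed
  then have "inf_norm (?x - 0\<^sub>v (Suc N)) \<le> N * \<beta> * \<Delta>"
    using assms by (auto simp: inf_norm_le_iff)
  with lower[OF mem] have "inf_norm (?x - 0\<^sub>v (Suc N)) = N * \<beta> * \<Delta>" by simp
  with mem lower show ?thesis by (simp add: is_minimum_def)
qed

theorem proposition1:
  fixes \<beta> :: real
  assumes "0 < \<beta>" and "\<beta> < 1"
  shows "(\<forall>(n::nat) (\<Delta>::int). n \<ge> 1 \<longrightarrow> \<Delta> \<ge> 1 \<longrightarrow>
            (\<exists>A b h. ilp_data n A b h \<and> has_subdeterminant A \<Delta> \<and>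
               is_minimum (optimal_distances A b h) ((real n - 1) * \<beta> * real_of_int \<Delta>)))
       \<and> (\<exists>c>0. \<exists>n0::nat. \<forall>n\<ge>n0. \<forall>\<Delta>::int. \<Delta> \<ge> 1 \<longrightarrow>
            (real n - 1) * \<beta> * real_of_int \<Delta> \<ge> c * (real n * real_of_int \<Delta>))"
proof (intro conjI allI impI)
  fix n :: nat and \<Delta> :: int
  assume "n \<ge> 1" and \<Delta>: "\<Delta> \<ge> 1"
  then obtain N where n: "n = Suc N" by (cases n) auto
  then have "(real n - 1) * \<beta> * real_of_int \<Delta> = N * \<beta> * \<Delta>" by simp
  with n \<Delta> show "\<exists>A b h. ilp_data n A b h \<and> has_subdeterminant A \<Delta> \<and>
      is_minimum (optimal_distances A b h) ((real n - 1) * \<beta> * real_of_int \<Delta>)"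
    using ilp_data_gap has_subdeterminant_gap_mat is_minimum_optimal_distances_gap[OF _ assms]
    by metis
next
  \<comment> \<open>The constants are c = \<beta>/2 and n0 = 2, since n - 1 \<ge> n/2 for n \<ge>
    2.\<close>
  have "\<beta> / 2 * (real n * \<Delta>) \<le> (real n - 1) * \<beta> * \<Delta>" if "n \<ge> 2" "\<Delta> \<ge> 1" for n and \<Delta> :: int
  proof -
    have "real n / 2 * (\<beta> * \<Delta>) \<le> (real n - 1) * (\<beta> * \<Delta>)"
      using that assms by (intro mult_right_mono) auto
    then show ?thesis by (simp add: mult_ac)
  qed
  then show "\<exists>c>0. \<exists>n0::nat. \<forall>n\<ge>n0. \<forall>\<Delta>::int. \<Delta> \<ge> 1 \<longrightarrow>
      (real n - 1) * \<beta> * real_of_int \<Delta> \<ge> c * (real n * real_of_int \<Delta>)"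
    using assms by (intro exI[of _ "\<beta> / 2"] conjI exI[of _ 2]) auto
qed

end
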